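(* Let $H$ be a finite dimensional Hilbert space and $\rho$ a linear functional on $B(H)\otimes B(H)$ with $\rho(1)=1$. Then the following conditions are equivalent. (i) $\rho$ is a PPT-state. (ii) $\rho$ is positive on the set $E=\{x\in B(H\otimes H): x\ge 0 \text{ or } (\iota\otimes t)(x)\ge 0\}$. (iii) $\rho$ is positive on the cone $\{x\in B(H\otimes H): (\iota\otimes\alpha)(x)\ge 0\ \ \forall\,\alpha\in\mathcal P\}$.
   Context: $H$ is a finite dimensional complex Hilbert space, $t$ is the transpose map on $B(H)$ with respect to a fixed orthonormal basis, $\iota$ is the identity map of $B(H)$, and $B(H)\otimes B(H)=B(H\otimes H)$. $P(H)$ is the cone of positive linear maps $B(H)\to B(H)$. A map $\phi\in P(H)$ is copositive if $t\circ\phi$ is completely positive. $\mathcal P$ denotes the cone of maps $\phi\in P(H)$ that are both completely positive and copositive. A state is a positive linear functional with value $1$ at the identity $1$. A state $\rho$ on $B(H)\otimes B(H)$ is called a PPT-state if $\rho\circ(\iota\otimes t)$ is also a state. A linear functional is positive on a set if it takes values $\ge 0$ on that set. *)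

theory Defs
  imports "HOL-Analysis.Analysis" "HOL-Library.Complex_Order"
begin

text \<open>
  The fixed orthonormal basis identifies \<open>H\<close> with \<open>complex ^ 'n\<close>, hence \<open>B(H)\<close> with the square
  matrices \<open>complex ^ 'n ^ 'n\<close>, and \<open>H \<otimes> H\<close> with \<open>complex ^ ('n \<times> 'n)\<close> via the product basis.
  The transpose map with respect to that basis is \<^const>\<open>transpose\<close>, and the identity operator is
  \<^term>\<open>mat 1\<close>.

  The order used on scalars is that of \<^theory>\<open>HOL-Library.Complex_Order\<close>: \<open>0 \<le> z\<close> means that \<open>z\<close> is
  real and nonnegative.  On matrices \<open>\<le>\<close> would be the entrywise order, so operator positivity
  is always expressed by \<open>pos_op\<close>.
\<close>

type_synonym 'n op = "((complex, 'n) vec, 'n) vec"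

definition cinner :: "complex ^ 'n::finite \<Rightarrow> complex ^ 'n \<Rightarrow> complex" where
  "cinner x y = (\<Sum>i\<in>UNIV. x $ i * cnj (y $ i))"

definition pos_op :: "'n::finite op \<Rightarrow> bool" where
  "pos_op A \<longleftrightarrow> (\<forall>v. 0 \<le> cinner (A *v v) v)"

definition scale_op :: "complex \<Rightarrow> complex ^ 'n::finite ^ 'm::finite \<Rightarrow> complex ^ 'n ^ 'm" where
  "scale_op c A = (\<chi> i j. c * A $ i $ j)"

definition linear_op :: "(complex ^ 'a ^ 'b \<Rightarrow> complex ^ 'c ^ 'd) \<Rightarrow> bool" where
  "linear_op \<phi> \<longleftrightarrow> Vector_Spaces.linear scale_op scale_op \<phi>"

definition linear_functional :: "(complex ^ 'a ^ 'b \<Rightarrow> complex) \<Rightarrow> bool" where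
  "linear_functional \<rho> \<longleftrightarrow> Vector_Spaces.linear scale_op (*) \<rho>"

definition positive_maps :: "('n::finite op \<Rightarrow> 'n op) set" where
  "positive_maps = {\<phi>. linear_op \<phi> \<and> (\<forall>A. pos_op A \<longrightarrow> pos_op (\<phi> A))}"

text \<open>
  An element of \<open>M\<^sub>k(B(H))\<close>, i.e. an operator on the direct sum of \<open>k\<close> copies of \<open>H\<close>, is given by
  its blocks \<open>X i j\<close> with \<open>i, j < k\<close>; the size \<open>k\<close> is a number rather than a type, so that it can
  be quantified in the definition of complete positivity.  \<open>pos_blocks k X\<close> says that
  \<open>\<langle>X v, v\<rangle> \<ge> 0\<close> for every vector \<open>v = (v\<^sub>0, \<dots>, v\<^sub>k\<^sub>-\<^sub>1)\<close> of that sum.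
\<close>

definition pos_blocks :: "nat \<Rightarrow> (nat \<Rightarrow> nat \<Rightarrow> 'n::finite op) \<Rightarrow> bool" where
  "pos_blocks k X \<longleftrightarrow>
     (\<forall>v :: nat \<Rightarrow> complex ^ 'n. 0 \<le> (\<Sum>i<k. cinner (\<Sum>j<k. X i j *v v j) (v i)))"

definition completely_positive :: "('n::finite op \<Rightarrow> 'n op) \<Rightarrow> bool" where
  "completely_positive \<phi> \<longleftrightarrow>
     linear_op \<phi> \<and> (\<forall>k X. pos_blocks k X \<longrightarrow> pos_blocks k (\<lambda>i j. \<phi> (X i j)))"

definition copositive :: "('n::finite op \<Rightarrow> 'n op) \<Rightarrow> bool" where
  "copositive \<phi> \<longleftrightarrow> \<phi> \<in> positive_maps \<and> completely_positive (transpose \<circ> \<phi>)"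

definition PPT_maps :: "('n::finite op \<Rightarrow> 'n op) set" where
  "PPT_maps = {\<phi> \<in> positive_maps. completely_positive \<phi> \<and> copositive \<phi>}"

text \<open>
  \<open>id_tensor \<alpha>\<close> is \<open>\<iota> \<otimes> \<alpha>\<close>: the map \<open>\<alpha>\<close> is applied to each block
  \<open>(x (i, k) (j, l))\<^sub>k\<^sub>l\<close> of \<open>x = \<Sum>\<^sub>i\<^sub>j e\<^sub>i\<^sub>j \<otimes> block i j x\<close>.  The lemma \<open>id_tensor_iff\<close> below shows that, for
  linear \<open>\<alpha>\<close>, this is the unique linear map sending every \<open>a \<otimes> b\<close> to \<open>a \<otimes> \<alpha> b\<close>.
\<close>

definition block :: "'m::finite \<Rightarrow> 'm \<Rightarrow> ('m \<times> 'n::finite) op \<Rightarrow> 'n op" where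
  "block i j x = (\<chi> k l. x $ (i, k) $ (j, l))"

definition id_tensor :: "('n::finite op \<Rightarrow> 'n op) \<Rightarrow> ('m::finite \<times> 'n) op \<Rightarrow> ('m \<times> 'n) op" where
  "id_tensor \<alpha> x = (\<chi> p q. \<alpha> (block (fst p) (fst q) x) $ snd p $ snd q)"

definition tensor_op :: "'m::finite op \<Rightarrow> 'n::finite op \<Rightarrow> ('m \<times> 'n) op" where
  "tensor_op a b = (\<chi> p q. a $ fst p $ fst q * b $ snd p $ snd q)"

definition positive_on :: "('a \<Rightarrow> complex) \<Rightarrow> 'a set \<Rightarrow> bool" where
  "positive_on \<rho> S \<longleftrightarrow> (\<forall>x\<in>S. 0 \<le> \<rho> x)"

definition state :: "('n::finite op \<Rightarrow> complex) \<Rightarrow> bool" where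
  "state \<rho> \<longleftrightarrow> linear_functional \<rho> \<and> positive_on \<rho> {x. pos_op x} \<and> \<rho> (mat 1) = 1"

definition PPT_state :: "(('n::finite \<times> 'n) op \<Rightarrow> complex) \<Rightarrow> bool" where
  "PPT_state \<rho> \<longleftrightarrow> state \<rho> \<and> state (\<rho> \<circ> id_tensor transpose)"

lemma vector_space_scale_op: "vector_space (scale_op :: complex \<Rightarrow> complex ^ 'n ^ 'm \<Rightarrow> _)"
  by unfold_locales (simp_all add: scale_op_def vec_eq_iff algebra_simps)

lemma linear_op_iff:
  "linear_op \<phi> \<longleftrightarrow>
     (\<forall>x y. \<phi> (x + y) = \<phi> x + \<phi> y) \<and> (\<forall>c x. \<phi> (scale_op c x) = scale_op c (\<phi> x))"
  unfolding linear_op_def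
  by (simp add: Vector_Spaces.linear_iff vector_space_scale_op)

lemma linear_functional_iff:
  "linear_functional \<rho> \<longleftrightarrow>
     (\<forall>x y. \<rho> (x + y) = \<rho> x + \<rho> y) \<and> (\<forall>c x. \<rho> (scale_op c x) = c * \<rho> x)"
proof -
  have "vector_space ((*) :: complex \<Rightarrow> complex \<Rightarrow> complex)"
    by unfold_locales (simp_all add: algebra_simps)
  then show ?thesis
    unfolding linear_functional_def
    by (simp add: Vector_Spaces.linear_iff vector_space_scale_op)
qed

lemma linear_op_sum:
  assumes "linear_op \<phi>"
  shows "\<phi> (sum f S) = (\<Sum>i\<in>S. \<phi> (f i))"
proof -
  have add: "\<phi> (x + y) = \<phi> x + \<phi> y" for x y
    using assms unfolding linear_op_iff by blast
  have "\<phi> 0 = 0"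
    using add[of 0 0] by simp
  then show ?thesis
    by (induction S rule: infinite_finite_induct) (simp_all add: add)
qed

lemma linear_op_transpose: "linear_op (transpose :: 'n::finite op \<Rightarrow> 'n op)"
  by (simp add: linear_op_iff transpose_def scale_op_def vec_eq_iff)

lemma linear_op_id_tensor:
  fixes \<alpha> :: "'n::finite op \<Rightarrow> 'n op"
  assumes "linear_op \<alpha>"
  shows "linear_op (id_tensor \<alpha> :: ('m::finite \<times> 'n) op \<Rightarrow> ('m \<times> 'n) op)"
proof -
  have add: "\<alpha> (block i j (x + y)) = \<alpha> (block i j x) + \<alpha> (block i j y)"
    for i j and x y :: "('m \<times> 'n) op"
  proof -
    have "block i j (x + y) = block i j x + block i j y"
      by (simp add: block_def vec_eq_iff)
    then show ?thesis
      using assms unfolding linear_op_iff by metis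
  qed
  have scale: "\<alpha> (block i j (scale_op c x)) = scale_op c (\<alpha> (block i j x))"
    for i j c and x :: "('m \<times> 'n) op"
  proof -
    have "block i j (scale_op c x) = scale_op c (block i j x)"
      by (simp add: block_def scale_op_def vec_eq_iff)
    then show ?thesis
      using assms unfolding linear_op_iff by metis
  qed
  show ?thesis
    unfolding linear_op_iff id_tensor_def add scale
    by (simp add: vec_eq_iff scale_op_def)
qed

lemma id_tensor_tensor_op:
  assumes "linear_op \<alpha>"
  shows "id_tensor \<alpha> (tensor_op a b) = tensor_op a (\<alpha> b)"
proof -
  have "block i j (tensor_op a b) = scale_op (a $ i $ j) b" for i j
    by (simp add: block_def tensor_op_def scale_op_def vec_eq_iff)
  then have "\<alpha> (block i j (tensor_op a b)) = scale_op (a $ i $ j) (\<alpha> b)" for i j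
    using assms unfolding linear_op_iff by metis
  then show ?thesis
    by (simp add: id_tensor_def tensor_op_def vec_eq_iff scale_op_def)
qed

lemma op_eq_sum_tensor_op:
  fixes x :: "('m::finite \<times> 'n::finite) op"
  shows "x = (\<Sum>(i, j)\<in>UNIV. tensor_op (\<chi> k l. if k = i \<and> l = j then 1 else 0) (block i j x))"
proof -
  have "(\<Sum>(i, j)\<in>UNIV. tensor_op (\<chi> k l. if k = i \<and> l = j then 1 else 0) (block i j x)) $ p $ q
      = x $ p $ q" for p q
  proof -
    have "(\<Sum>(i, j)\<in>UNIV. tensor_op (\<chi> k l. if k = i \<and> l = j then 1 else 0) (block i j x)) $ p $ q
        = (\<Sum>r\<in>UNIV. if r = (fst p, fst q) then x $ p $ q else 0)"
      unfolding sum_component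
      by (intro sum.cong) (auto simp: tensor_op_def block_def split: if_splits)
    then show ?thesis
      by simp
  qed
  then show ?thesis
    unfolding vec_eq_iff by metis
qed

lemma id_tensor_iff:
  fixes F :: "('m::finite \<times> 'n::finite) op \<Rightarrow> ('m \<times> 'n) op"
  assumes "linear_op \<alpha>"
  shows "F = id_tensor \<alpha> \<longleftrightarrow> linear_op F \<and> (\<forall>a b. F (tensor_op a b) = tensor_op a (\<alpha> b))"
proof (intro iffI)
  assume F: "linear_op F \<and> (\<forall>a b. F (tensor_op a b) = tensor_op a (\<alpha> b))"
  show "F = id_tensor \<alpha>"
  proof
    fix x :: "('m \<times> 'n) op"
    define g where "g = (\<lambda>(i, j). tensor_op (\<chi> k l. if k = i \<and> l = j then 1 else 0) (block i j x))"
    have "x = sum g UNIV"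
      unfolding g_def by (rule op_eq_sum_tensor_op)
    then have "F x = (\<Sum>r\<in>UNIV. F (g r))"
      using F linear_op_sum[of F g UNIV] by metis
    also have "\<dots> = (\<Sum>r\<in>UNIV. id_tensor \<alpha> (g r))"
    proof (rule sum.cong[OF refl])
      fix r :: "'m \<times> 'm"
      obtain i j where "r = (i, j)"
        by (cases r)
      then have "g r = tensor_op (\<chi> k l. if k = i \<and> l = j then 1 else 0) (block i j x)"
        by (simp only: g_def prod.case)
      then show "F (g r) = id_tensor \<alpha> (g r)"
        by (simp only: F id_tensor_tensor_op[OF assms])
    qed
    also have "\<dots> = id_tensor \<alpha> x"
      using linear_op_sum[OF linear_op_id_tensor[OF assms], of g UNIV] \<open>x = sum g UNIV\<close> by metis
    finally show "F x = id_tensor \<alpha> x" .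
  qed
next
  assume "F = id_tensor \<alpha>"
  then show "linear_op F \<and> (\<forall>a b. F (tensor_op a b) = tensor_op a (\<alpha> b))"
    by (simp only: linear_op_id_tensor[OF assms] id_tensor_tensor_op[OF assms] simp_thms)
qed

end

theory Submission
  imports Defs
begin

text \<open>
  Writing \<open>\<Omega> = \<Sum>\<^sub>i e\<^sub>i \<otimes> e\<^sub>i\<close>, every functional satisfies \<open>\<rho>(x) = \<langle>(\<iota> \<otimes> \<alpha>)(x) \<Omega>, \<Omega>\<rangle>\<close> for the map
  \<open>\<alpha>(b)\<^sub>k\<^sub>l = \<rho>(e\<^sub>k\<^sub>l \<otimes> b)\<close>. If \<open>\<rho>\<close> is positive, \<open>\<alpha>\<close> is completely positive, and \<open>t \<circ> \<alpha>\<close> is the map belonging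
  to \<open>\<rho> \<circ> (\<iota> \<otimes> t)\<close> composed with the full transpose, so a PPT-state yields \<open>\<alpha> \<in> \<P>\<close> and is therefore
  positive on the cone in (iii). Conversely that cone contains \<open>E\<close>: for \<open>\<alpha> \<in> \<P>\<close> both \<open>\<alpha>\<close> and
  \<open>\<alpha> \<circ> t = t \<circ> (t \<circ> \<alpha>) \<circ> t\<close> are completely positive.
\<close>

section \<open>Quadratic forms, block positivity and transposition\<close>

lemma cinner_sum_left: "cinner (sum f S) w = (\<Sum>j\<in>S. cinner (f j) w)"
  unfolding cinner_def sum_component sum_distrib_right by (rule sum.swap)

lemma matrix_vector_mult_sum_left: "sum f S *v v = (\<Sum>i\<in>S. f i *v v)"
  by (induction S rule: infinite_finite_induct) (simp_all add: matrix_vector_mult_add_rdistrib)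

lemma cinner_matrix_vector:
  "cinner (A *v v) w = (\<Sum>a\<in>UNIV. \<Sum>b\<in>UNIV. A $ a $ b * v $ b * cnj (w $ a))"
  by (simp add: cinner_def matrix_vector_mult_def sum_distrib_right)

lemma cinner_transpose:
  "cinner (transpose A *v v) w = cinner (A *v (\<chi> i. cnj (w $ i))) (\<chi> i. cnj (v $ i))"
  unfolding cinner_matrix_vector by (subst sum.swap) (simp add: transpose_def mult_ac)

text \<open>Swapping the block indices and transposing each block is the transpose of the whole
  block operator. Its quadratic form at a vector is that of \<open>X\<close> at the entrywise
  conjugate vector.\<close>

lemma pos_blocks_transpose:
  assumes "pos_blocks k X"
  shows "pos_blocks k (\<lambda>i j. transpose (X j i))"
  unfolding pos_blocks_def
proof
  fix v :: "nat \<Rightarrow> complex ^ 'a"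
  let ?w = "\<lambda>i. \<chi> a. cnj (v i $ a)"
  have "(\<Sum>i<k. cinner (\<Sum>j<k. transpose (X j i) *v v j) (v i))
      = (\<Sum>i<k. \<Sum>j<k. cinner (X j i *v ?w i) (?w j))"
    by (simp add: cinner_sum_left cinner_transpose del: transpose_matrix_vector)
  also have "\<dots> = (\<Sum>i<k. cinner (\<Sum>j<k. X i j *v ?w j) (?w i))"
    by (subst sum.swap) (simp add: cinner_sum_left)
  finally show "0 \<le> (\<Sum>i<k. cinner (\<Sum>j<k. transpose (X j i) *v v j) (v i))"
    using assms by (simp add: pos_blocks_def)
qed

lemma pos_op_transpose: "pos_op A \<Longrightarrow> pos_op (transpose A)"
  by (simp add: pos_op_def cinner_transpose del: transpose_matrix_vector)

lemma pos_blocks_Suc_0: "pos_blocks (Suc 0) X \<longleftrightarrow> pos_op (X 0 0)"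
proof
  assume X: "pos_blocks (Suc 0) X"
  show "pos_op (X 0 0)"
    unfolding pos_op_def
  proof
    fix v
    show "0 \<le> cinner (X 0 0 *v v) v"
      using X[unfolded pos_blocks_def, rule_format, of "\<lambda>_. v"] by simp
  qed
qed (simp add: pos_blocks_def pos_op_def)

lemma completely_positive_imp_positive_maps:
  assumes "completely_positive \<phi>"
  shows "\<phi> \<in> positive_maps"
proof -
  have "pos_op (\<phi> A)" if "pos_op A" for A
  proof -
    have "pos_blocks (Suc 0) (\<lambda>_ _. A)"
      using that by (simp add: pos_blocks_Suc_0)
    then have "pos_blocks (Suc 0) (\<lambda>_ _. \<phi> A)"
      using assms by (simp add: completely_positive_def)
    then show ?thesis
      by (simp add: pos_blocks_Suc_0)
  qed
  then show ?thesis
    using assms by (simp add: positive_maps_def completely_positive_def)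
qed

text \<open>Transposing the blocks alone need not preserve positivity, but the two transposes can be
  completed to full block transposes. The index swap made before \<phi> is undone by the one made
  after it.\<close>

lemma completely_positive_transpose_conj:
  assumes "completely_positive \<phi>"
  shows "completely_positive (transpose \<circ> \<phi> \<circ> transpose)"
  unfolding completely_positive_def
proof (intro conjI allI impI)
  show "linear_op (transpose \<circ> \<phi> \<circ> transpose)"
    using assms linear_op_transpose[where 'n='a]
    unfolding completely_positive_def linear_op_iff by simp
next
  fix k and X :: "nat \<Rightarrow> nat \<Rightarrow> 'a op"
  assume "pos_blocks k X"
  then have "pos_blocks k (\<lambda>i j. \<phi> (transpose (X j i)))"
    using assms pos_blocks_transpose unfolding completely_positive_def by blast
  from pos_blocks_transpose[OF this]
  show "pos_blocks k (\<lambda>i j. (transpose \<circ> \<phi> \<circ> transpose) (X i j))"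
    by simp
qed

section \<open>Amplifications of completely positive maps\<close>

lemma block_id_tensor: "block i j (id_tensor \<alpha> x) = \<alpha> (block i j x)"
  by (simp add: block_def id_tensor_def vec_eq_iff)

lemma id_tensor_id_tensor: "id_tensor \<alpha> (id_tensor \<beta> x) = id_tensor (\<alpha> \<circ> \<beta>) x"
  by (simp add: id_tensor_def[of \<alpha>] id_tensor_def[of "\<alpha> \<circ> \<beta>"] block_id_tensor)

lemma id_tensor_transpose_invol: "id_tensor transpose (id_tensor transpose x) = x"
  by (simp add: id_tensor_def block_def transpose_def vec_eq_iff)

lemma id_tensor_transpose_mat_1: "id_tensor transpose (mat 1) = mat 1"
  by (auto simp: id_tensor_def block_def transpose_def vec_eq_iff mat_def)

lemma cinner_blocks:
  fixes x :: "('m::finite \<times> 'n::finite) op"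
  shows "cinner (x *v v) v =
    (\<Sum>i\<in>UNIV. \<Sum>j\<in>UNIV. cinner (block i j x *v (\<chi> b. v $ (j, b))) (\<chi> a. v $ (i, a)))"
proof -
  have "cinner (x *v v) v = (\<Sum>i\<in>UNIV. \<Sum>a\<in>UNIV. \<Sum>j\<in>UNIV. \<Sum>b\<in>UNIV.
      x $ (i, a) $ (j, b) * v $ (j, b) * cnj (v $ (i, a)))"
    unfolding cinner_matrix_vector UNIV_Times_UNIV[symmetric] sum.cartesian_product'
    by (simp add: sum.cartesian_product')
  also have "\<dots> = (\<Sum>i\<in>UNIV. \<Sum>j\<in>UNIV. \<Sum>a\<in>UNIV. \<Sum>b\<in>UNIV.
      x $ (i, a) $ (j, b) * v $ (j, b) * cnj (v $ (i, a)))"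
    by (intro sum.cong[OF refl] sum.swap)
  finally show ?thesis
    by (simp add: cinner_matrix_vector block_def)
qed

text \<open>The enumeration \<open>h\<close> of the first tensor factor's basis identifies the
  tensor product with a direct sum of \<open>k\<close> copies of the second factor. This links
  operators indexed by a type to the blocks indexed by numbers in
  \<open>completely_positive\<close>.\<close>

lemma pos_op_iff_pos_blocks:
  fixes x :: "('m::finite \<times> 'n::finite) op"
  assumes h: "bij_betw h {..<k} (UNIV :: 'm set)"
  shows "pos_op x \<longleftrightarrow> pos_blocks k (\<lambda>i j. block (h i) (h j) x)"
proof -
  let ?q = "\<lambda>v :: nat \<Rightarrow> complex ^ 'n.
    \<Sum>i<k. cinner (\<Sum>j<k. block (h i) (h j) x *v v j) (v i)"
  have eq: "cinner (x *v v) v = ?q (\<lambda>i. \<chi> a. v $ (h i, a))" for v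
    unfolding cinner_blocks cinner_sum_left
    by (simp add: sum.reindex_bij_betw[OF h, symmetric])
  have "0 \<le> ?q v" if "pos_op x" for v
  proof -
    \<comment> \<open>The components \<open>v i\<close> with \<open>i < k\<close> are glued into one
      vector; those beyond \<open>k\<close> do not enter the form.\<close>
    define w :: "complex ^ ('m \<times> 'n)" where "w = (\<chi> p. v (inv_into {..<k} h (fst p)) $ snd p)"
    have "inv_into {..<k} h (h i) = i" if "i < k" for i
      using h that by (simp add: bij_betw_def)
    then have "(\<chi> a. w $ (h i, a)) = v i" if "i < k" for i
      using that by (simp add: w_def vec_eq_iff)
    then have "?q (\<lambda>i. \<chi> a. w $ (h i, a)) = ?q v"
      by simp
    then show ?thesis
      using that eq[of w] unfolding pos_op_def by metis
  qed
  moreover have "pos_op x" if "\<forall>v. 0 \<le> ?q v"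
    using that by (simp add: pos_op_def eq)
  ultimately show ?thesis
    unfolding pos_blocks_def by blast
qed

lemma pos_op_id_tensor:
  fixes x :: "('m::finite \<times> 'n::finite) op"
  assumes "completely_positive \<phi>" and "pos_op x"
  shows "pos_op (id_tensor \<phi> x)"
proof -
  obtain h where h: "bij_betw h {..<CARD('m)} (UNIV :: 'm set)"
    using ex_bij_betw_nat_finite[of "UNIV :: 'm set"] by (auto simp: atLeast0LessThan)
  have "pos_blocks CARD('m) (\<lambda>i j. \<phi> (block (h i) (h j) x))"
    using assms pos_op_iff_pos_blocks[OF h] unfolding completely_positive_def by blast
  then show ?thesis
    by (simp add: pos_op_iff_pos_blocks[OF h] block_id_tensor)
qed

lemma pos_op_id_tensor_PPT_maps:
  assumes \<alpha>: "\<alpha> \<in> PPT_maps" and x: "pos_op x \<or> pos_op (id_tensor transpose x)"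
  shows "pos_op (id_tensor \<alpha> x)"
  using x
proof
  assume "pos_op x"
  then show ?thesis
    using \<alpha> by (simp add: PPT_maps_def pos_op_id_tensor)
next
  assume x: "pos_op (id_tensor transpose x)"
  have "completely_positive (transpose \<circ> \<alpha>)"
    using \<alpha> by (simp add: PPT_maps_def copositive_def)
  from completely_positive_transpose_conj[OF this]
  have "completely_positive (\<alpha> \<circ> transpose)"
    by (simp add: comp_def)
  \<comment> \<open>The transpose in \<alpha> \<circ> t cancels the one already applied to
    \<open>x\<close>.\<close>
  from pos_op_id_tensor[OF this x] show ?thesis
    by (simp add: id_tensor_id_tensor comp_def)
qed

section \<open>The map associated with a functional\<close>

definition unit_op :: "'n::finite \<Rightarrow> 'n \<Rightarrow> 'n op" where
  "unit_op i j = (\<chi> k l. if k = i \<and> l = j then 1 else 0)"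

text \<open>The Choi correspondence between functionals and maps. With entry (i, j) taken at e_ij
  rather than e_ji, positive functionals give completely positive maps, not copositive ones.\<close>

definition choi_map :: "(('n::finite \<times> 'n) op \<Rightarrow> complex) \<Rightarrow> 'n op \<Rightarrow> 'n op" where
  "choi_map \<rho> b = (\<chi> i j. \<rho> (tensor_op (unit_op i j) b))"

lemma linear_functional_sum:
  assumes "linear_functional \<rho>"
  shows "\<rho> (sum f S) = (\<Sum>i\<in>S. \<rho> (f i))"
proof -
  have add: "\<rho> (x + y) = \<rho> x + \<rho> y" for x y
    using assms unfolding linear_functional_iff by blast
  have "\<rho> 0 = 0"
    using add[of 0 0] by simp
  then show ?thesis
    by (induction S rule: infinite_finite_induct) (simp_all add: add)
qed

lemma linear_op_choi_map:
  assumes "linear_functional \<rho>"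
  shows "linear_op (choi_map \<rho>)"
proof -
  have "tensor_op a (x + y) = tensor_op a x + tensor_op a y"
    and "tensor_op a (scale_op c x) = scale_op c (tensor_op a x)"
    for a :: "'a op" and c and x y :: "'a op"
    by (simp_all add: tensor_op_def scale_op_def vec_eq_iff algebra_simps)
  then have "choi_map \<rho> (x + y) $ i $ j = (choi_map \<rho> x + choi_map \<rho> y) $ i $ j"
    and "choi_map \<rho> (scale_op c x) $ i $ j = c * choi_map \<rho> x $ i $ j" for c x y i j
    using assms unfolding linear_functional_iff by (simp_all add: choi_map_def)
  then show ?thesis
    unfolding linear_op_iff by (simp add: vec_eq_iff scale_op_def)
qed

lemma functional_eq_choi_map:
  assumes "linear_functional \<rho>"
  shows "\<rho> x = (\<Sum>i\<in>UNIV. \<Sum>j\<in>UNIV. choi_map \<rho> (block i j x) $ i $ j)"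
proof -
  have "\<rho> x = \<rho> (\<Sum>(i, j)\<in>UNIV. tensor_op (unit_op i j) (block i j x))"
    unfolding unit_op_def by (rule arg_cong[where f=\<rho>], rule op_eq_sum_tensor_op)
  also have "\<dots> = (\<Sum>(i, j)\<in>UNIV. \<rho> (tensor_op (unit_op i j) (block i j x)))"
    unfolding linear_functional_sum[OF assms] by (simp add: case_prod_unfold)
  also have "\<dots> = (\<Sum>i\<in>UNIV. \<Sum>j\<in>UNIV. \<rho> (tensor_op (unit_op i j) (block i j x)))"
    by (simp add: sum.cartesian_product)
  finally show ?thesis
    by (simp add: choi_map_def)
qed

text \<open>Block \<open>i\<close> of \<Omega> is the basis vector e_i, so the form at \<Omega>
  picks entry (i, j) out of block (i, j). Hence positivity of the amplified operator at this one
  vector gives 0 \<le> \<rho> x.\<close>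

lemma functional_eq_cinner:
  fixes \<rho> :: "('n::finite \<times> 'n) op \<Rightarrow> complex"
  assumes "linear_functional \<rho>"
  defines "\<Omega> \<equiv> (\<chi> p. if fst p = snd p then 1 else 0) :: complex ^ ('n \<times> 'n)"
  shows "\<rho> x = cinner (id_tensor (choi_map \<rho>) x *v \<Omega>) \<Omega>"
proof -
  have "cinner (A *v (\<chi> b. \<Omega> $ (j, b))) (\<chi> a. \<Omega> $ (i, a)) = A $ i $ j" for A :: "'n op" and i j
  proof -
    have "cinner (A *v (\<chi> b. \<Omega> $ (j, b))) (\<chi> a. \<Omega> $ (i, a))
        = (\<Sum>a\<in>UNIV. \<Sum>b\<in>UNIV. if b = j then if a = i then A $ a $ b else 0 else 0)"
      unfolding cinner_matrix_vector by (intro sum.cong[OF refl]) (simp add: \<Omega>_def)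
    then show ?thesis
      by simp
  qed
  then show ?thesis
    unfolding functional_eq_choi_map[OF assms(1), of x] cinner_blocks block_id_tensor by simp
qed

text \<open>The form of the image blocks at \<open>v\<close> is the value of \<rho> at an operator
  \<open>Y\<close> built from \<open>v\<close> and \<open>X\<close>, and \<open>Y\<close> inherits
  positivity from \<open>X\<close>.\<close>

lemma completely_positive_choi_map:
  fixes \<rho> :: "('n::finite \<times> 'n) op \<Rightarrow> complex"
  assumes lin: "linear_functional \<rho>" and pos: "\<And>x. pos_op x \<Longrightarrow> 0 \<le> \<rho> x"
  shows "completely_positive (choi_map \<rho>)"
  unfolding completely_positive_def
proof (intro conjI allI impI)
  show "linear_op (choi_map \<rho>)"
    using lin by (rule linear_op_choi_map)
next
  fix k and X :: "nat \<Rightarrow> nat \<Rightarrow> 'n op"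
  assume X: "pos_blocks k X"
  show "pos_blocks k (\<lambda>i j. choi_map \<rho> (X i j))"
    unfolding pos_blocks_def
  proof
    fix v :: "nat \<Rightarrow> complex ^ 'n"
    \<comment> \<open>These coefficients turn the entrywise pairing of \<open>a i j\<close> with a
      matrix \<open>M\<close> into \<open>cinner (M *v v j) (v i)\<close>.\<close>
    define a :: "nat \<Rightarrow> nat \<Rightarrow> 'n op" where "a i j = (\<chi> k l. cnj (v i $ k) * v j $ l)" for i j
    define Y where "Y = (\<Sum>i<k. \<Sum>j<k. tensor_op (a i j) (X i j))"
    have 1: "\<rho> (tensor_op (a i j) (X i j)) = cinner (choi_map \<rho> (X i j) *v v j) (v i)" for i j
    proof -
      have "block r s (tensor_op (a i j) (X i j)) = scale_op (a i j $ r $ s) (X i j)" for r s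
        by (simp add: block_def tensor_op_def scale_op_def vec_eq_iff)
      then have "\<rho> (tensor_op (a i j) (X i j))
          = (\<Sum>r\<in>UNIV. \<Sum>s\<in>UNIV. choi_map \<rho> (scale_op (a i j $ r $ s) (X i j)) $ r $ s)"
        by (simp add: functional_eq_choi_map[OF lin, of "tensor_op _ _"])
      moreover have "choi_map \<rho> (scale_op c (X i j)) $ r $ s = c * choi_map \<rho> (X i j) $ r $ s"
        for c r s
        using linear_op_choi_map[OF lin] unfolding linear_op_iff by (simp add: scale_op_def)
      ultimately show ?thesis
        by (simp add: cinner_matrix_vector a_def mult_ac)
    qed
    have "pos_op Y"
      unfolding pos_op_def
    proof
      fix w :: "complex ^ ('n \<times> 'n)"
      \<comment> \<open>Contracting the first factor of \<open>w\<close> against \<open>v i\<close>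
        reduces the form of \<open>Y\<close> at \<open>w\<close> to that of \<open>X\<close> at
        \<open>u\<close>.\<close>
      define u :: "nat \<Rightarrow> complex ^ 'n" where "u i = (\<chi> b. \<Sum>l\<in>UNIV. v i $ l * w $ (l, b))" for i
      have 2: "cinner (tensor_op (a i j) (X i j) *v w) w = cinner (X i j *v u j) (u i)" for i j
      proof -
        have "cinner (tensor_op (a i j) (X i j) *v w) w = (\<Sum>r\<in>UNIV. \<Sum>s\<in>UNIV. \<Sum>p\<in>UNIV. \<Sum>q\<in>UNIV.
            X i j $ p $ q * (v j $ s * w $ (s, q)) * cnj (v i $ r * w $ (r, p)))"
          unfolding cinner_blocks cinner_matrix_vector
          by (intro sum.cong[OF refl]) (simp add: block_def tensor_op_def a_def)
        \<comment> \<open>The sums over \<open>r\<close> and \<open>s\<close> are moved inside,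
          where they factor into the entries of \<open>u i\<close> and \<open>u j\<close>.\<close>
        also have "\<dots> = (\<Sum>r\<in>UNIV. \<Sum>p\<in>UNIV. \<Sum>s\<in>UNIV. \<Sum>q\<in>UNIV.
            X i j $ p $ q * (v j $ s * w $ (s, q)) * cnj (v i $ r * w $ (r, p)))"
          by (rule sum.cong[OF refl], rule sum.swap)
        also have "\<dots> = (\<Sum>r\<in>UNIV. \<Sum>p\<in>UNIV. \<Sum>q\<in>UNIV. \<Sum>s\<in>UNIV.
            X i j $ p $ q * (v j $ s * w $ (s, q)) * cnj (v i $ r * w $ (r, p)))"
          by (rule sum.cong[OF refl], rule sum.cong[OF refl], rule sum.swap)
        also have "\<dots> = (\<Sum>p\<in>UNIV. \<Sum>r\<in>UNIV. \<Sum>q\<in>UNIV. \<Sum>s\<in>UNIV.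
            X i j $ p $ q * (v j $ s * w $ (s, q)) * cnj (v i $ r * w $ (r, p)))"
          by (rule sum.swap)
        also have "\<dots> = (\<Sum>p\<in>UNIV. \<Sum>q\<in>UNIV. \<Sum>r\<in>UNIV. \<Sum>s\<in>UNIV.
            X i j $ p $ q * (v j $ s * w $ (s, q)) * cnj (v i $ r * w $ (r, p)))"
          by (rule sum.cong[OF refl], rule sum.swap)
        also have "\<dots> = cinner (X i j *v u j) (u i)"
          by (simp only: cinner_matrix_vector u_def vec_lambda_beta cnj_sum sum_distrib_left)
            (simp only: sum_distrib_right)
        finally show ?thesis .
      qed
      have "cinner (Y *v w) w = (\<Sum>i<k. \<Sum>j<k. cinner (tensor_op (a i j) (X i j) *v w) w)"
        by (simp add: Y_def matrix_vector_mult_sum_left cinner_sum_left)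
      also have "\<dots> = (\<Sum>i<k. cinner (\<Sum>j<k. X i j *v u j) (u i))"
        by (simp add: 2 cinner_sum_left)
      finally show "0 \<le> cinner (Y *v w) w"
        using X unfolding pos_blocks_def by simp
    qed
    then have "0 \<le> \<rho> Y"
      by (rule pos)
    also have "\<rho> Y = (\<Sum>i<k. cinner (\<Sum>j<k. choi_map \<rho> (X i j) *v v j) (v i))"
      by (simp add: Y_def linear_functional_sum[OF lin] 1 cinner_sum_left)
    finally show "0 \<le> (\<Sum>i<k. cinner (\<Sum>j<k. choi_map \<rho> (X i j) *v v j) (v i))" .
  qed
qed

lemma choi_map_PPT_maps:
  fixes \<rho> :: "('n::finite \<times> 'n) op \<Rightarrow> complex"
  assumes lin: "linear_functional \<rho>"
    and pos: "\<And>x. pos_op x \<Longrightarrow> 0 \<le> \<rho> x"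
    and pos_t: "\<And>x. pos_op (id_tensor transpose x) \<Longrightarrow> 0 \<le> \<rho> x"
  shows "choi_map \<rho> \<in> PPT_maps"
proof -
  \<comment> \<open>The full transpose followed by \<iota> \<otimes> t is t \<otimes> \<iota>. It
    swaps the indices of the matrix units, which puts t after the associated map; \<rho> \<circ>
    (\<iota> \<otimes> t) itself would put it before.\<close>
  define \<sigma> where "\<sigma> x = \<rho> (id_tensor transpose (transpose x))" for x
  have "linear_functional \<sigma>"
    using lin linear_op_transpose[where 'n="'n \<times> 'n"]
      linear_op_id_tensor[OF linear_op_transpose, where 'm='n and 'n='n]
    unfolding \<sigma>_def linear_functional_iff linear_op_iff by simp
  moreover have "0 \<le> \<sigma> x" if "pos_op x" for x
    unfolding \<sigma>_def by (rule pos_t) (simp add: id_tensor_transpose_invol pos_op_transpose that)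
  ultimately have "completely_positive (choi_map \<sigma>)"
    by (rule completely_positive_choi_map)
  moreover have "choi_map \<sigma> = transpose \<circ> choi_map \<rho>"
  proof -
    have "id_tensor transpose (transpose (tensor_op (unit_op i j) b)) = tensor_op (unit_op j i) b"
      for i j :: 'n and b :: "'n op"
      by (auto simp: vec_eq_iff id_tensor_def transpose_def block_def tensor_op_def unit_op_def)
    then show ?thesis
      by (simp add: fun_eq_iff choi_map_def \<sigma>_def transpose_def[of "vec_lambda _"])
  qed
  moreover have "completely_positive (choi_map \<rho>)"
    using lin pos by (rule completely_positive_choi_map)
  ultimately show ?thesis
    unfolding PPT_maps_def copositive_def using completely_positive_imp_positive_maps by auto
qed

section \<open>The equivalences\<close>

text \<open>Since \<iota> \<otimes> t is a linear involution fixing the identity, its composition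
  with \<rho> is a state exactly when \<rho> is nonnegative wherever (\<iota> \<otimes> t)(x) \<ge>
  0.\<close>

lemma PPT_state_iff:
  fixes \<rho> :: "('n::finite \<times> 'n) op \<Rightarrow> complex"
  assumes lin: "linear_functional \<rho>" and unit: "\<rho> (mat 1) = 1"
  shows "PPT_state \<rho> \<longleftrightarrow> positive_on \<rho> {x. pos_op x \<or> pos_op (id_tensor transpose x)}"
proof -
  have lin_t: "linear_functional (\<rho> \<circ> id_tensor transpose)"
    using lin linear_op_id_tensor[OF linear_op_transpose, where 'm='n and 'n='n]
    unfolding linear_functional_iff linear_op_iff by simp
  have 1: "state \<rho> \<longleftrightarrow> (\<forall>x. pos_op x \<longrightarrow> 0 \<le> \<rho> x)"
    by (simp add: state_def positive_on_def lin unit)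
  have "state (\<rho> \<circ> id_tensor transpose) \<longleftrightarrow> (\<forall>x. pos_op x \<longrightarrow> 0 \<le> \<rho> (id_tensor transpose x))"
    by (simp add: state_def positive_on_def lin_t id_tensor_transpose_mat_1 unit)
  also have "\<dots> \<longleftrightarrow> (\<forall>x. pos_op (id_tensor transpose x) \<longrightarrow> 0 \<le> \<rho> x)"
  proof (intro iffI allI impI)
    fix x :: "('n \<times> 'n) op"
    assume "\<forall>x. pos_op x \<longrightarrow> 0 \<le> \<rho> (id_tensor transpose x)" and "pos_op (id_tensor transpose x)"
    then have "0 \<le> \<rho> (id_tensor transpose (id_tensor transpose x))"
      by (elim allE impE)
    then show "0 \<le> \<rho> x"
      by (simp only: id_tensor_transpose_invol)
  next
    fix x :: "('n \<times> 'n) op"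
    assume *: "\<forall>x. pos_op (id_tensor transpose x) \<longrightarrow> 0 \<le> \<rho> x" and "pos_op x"
    then show "0 \<le> \<rho> (id_tensor transpose x)"
      by (intro *[rule_format]) (simp only: id_tensor_transpose_invol)
  qed
  finally show ?thesis
    unfolding PPT_state_def positive_on_def 1 by auto
qed

lemma positive_on_subset: "positive_on \<rho> T \<Longrightarrow> S \<subseteq> T \<Longrightarrow> positive_on \<rho> S"
  by (auto simp: positive_on_def)

theorem theorem11:
  fixes \<rho> :: "('n::finite \<times> 'n) op \<Rightarrow> complex"
  assumes "linear_functional \<rho>"
    and "\<rho> (mat 1) = 1"
  shows "(PPT_state \<rho> \<longleftrightarrow>
            positive_on \<rho> {x. pos_op x \<or> pos_op (id_tensor transpose x)})
       \<and> (positive_on \<rho> {x. pos_op x \<or> pos_op (id_tensor transpose x)} \<longleftrightarrow>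
            positive_on \<rho> {x. \<forall>\<alpha> \<in> PPT_maps. pos_op (id_tensor \<alpha> x)})"
proof (intro conjI iffI)
  assume E: "positive_on \<rho> {x. pos_op x \<or> pos_op (id_tensor transpose x)}"
  have "choi_map \<rho> \<in> PPT_maps"
    by (intro choi_map_PPT_maps[OF assms(1)] bspec[OF E[unfolded positive_on_def]]) simp_all
  \<comment> \<open>Membership in the cone is used only for \<alpha> =
    \<open>choi_map \<rho>\<close>, and the resulting positivity only at \<Omega>.\<close>
  then have "0 \<le> \<rho> x" if "\<forall>\<alpha> \<in> PPT_maps. pos_op (id_tensor \<alpha> x)" for x
    unfolding functional_eq_cinner[OF assms(1), of x]
    using bspec[OF that] unfolding pos_op_def by blast
  then show "positive_on \<rho> {x. \<forall>\<alpha> \<in> PPT_maps. pos_op (id_tensor \<alpha> x)}"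
    unfolding positive_on_def by blast
next
  assume "positive_on \<rho> {x. \<forall>\<alpha> \<in> PPT_maps. pos_op (id_tensor \<alpha> x)}"
  \<comment> \<open>The cone contains the set of (ii), so positivity restricts to it.\<close>
  then show "positive_on \<rho> {x. pos_op x \<or> pos_op (id_tensor transpose x)}"
    by (rule positive_on_subset)
      (intro subsetI CollectI ballI, rule pos_op_id_tensor_PPT_maps, simp_all)
qed (simp_all only: PPT_state_iff[OF assms])

end
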